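(* Let $f$ be a continuous convex real-valued function defined on a closed interval $[a,b]\subset\mathbb{R}$. Then for all real numbers $p,q\ge 0$ with $p+q=1$, $$2f\left(\frac{a+b}{2}\right)\le f(pa+qb)+f(pb+qa)\le f(a)+f(b).$$
   Context: A function $\phi$ on an interval is called convex if $\frac{\phi(x)+\phi(y)}{2}\ge \phi\left(\frac{x+y}{2}\right)$ for all $x,y$ in the interval; for continuous functions this is equivalent to the usual notion of convexity. *)

theory Defs
  imports Complex_Main
begin

(* Convexity in the midpoint (Jensen) sense; S is meant to be an interval.
   This is not the library's convex_on, with which it agrees only under extra
   regularity such as continuity. *)
definition midpoint_convex_on :: "real set \<Rightarrow> (real \<Rightarrow> real) \<Rightarrow> bool" where
  "midpoint_convex_on S f \<longleftrightarrow>
    (\<forall>x\<in>S. \<forall>y\<in>S. (f x + f y) / 2 \<ge> f ((x + y) / 2))"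

end

theory Submission
  imports Defs
begin

text \<open>
  The lower bound is midpoint convexity at the points \<open>p * a + q * b\<close> and \<open>p * b + q * a\<close>, whose
  midpoint is \<open>(a + b) / 2\<close>.

  For the upper bound, \<open>f\<close> is symmetrised about the centre of the interval, which makes it
  unnecessary to extend convexity from midpoints to arbitrary weights. The function
  \<open>\<lambda>x. f x + f (a + b - x)\<close> is again continuous and midpoint convex,
  takes the value \<open>f a + f b\<close> at both endpoints, and takes the value
  \<open>f (p * a + q * b) + f (p * b + q * a)\<close> at \<open>p * a + q * b\<close>. The upper bound is therefore
  the maximum principle \<open>midpoint_convex_le_max_endpoints\<close> for this function.
\<close>

text \<open>
  An interior point \<open>m\<close> where the maximum is attained is the midpoint of two points of the interval
  at equal distance from it; midpoint convexity forces the maximum to be attained at both of them.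
  Hence the leftmost maximiser, which exists by continuity, cannot be an interior point.
\<close>
lemma midpoint_convex_le_max_endpoints:
  assumes cont: "continuous_on {a..b} f"
    and conv: "midpoint_convex_on {a..b} f"
    and x: "x \<in> {a..b}"
  shows "f x \<le> max (f a) (f b)"
proof -
  obtain z where z: "z \<in> {a..b}" "\<And>y. y \<in> {a..b} \<Longrightarrow> f y \<le> f z"
    using continuous_attains_sup[OF compact_Icc _ cont] x by blast
  define S where "S = f -` {f z} \<inter> {a..b}"
  have "closed S"
    using cont unfolding S_def by (simp add: continuous_on_closed_vimage)
  then have "compact ({a..b} \<inter> S)"
    by (intro compact_Int_closed compact_Icc)
  moreover have "{a..b} \<inter> S = S" "z \<in> S"
    using z(1) by (auto simp: S_def)
  ultimately obtain m where m: "m \<in> S" "\<And>y. y \<in> S \<Longrightarrow> m \<le> y"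
    using compact_attains_inf[of S] by auto
  have m_ab: "a \<le> m" "m \<le> b" and fm: "f m = f z"
    using m(1) by (auto simp: S_def)
  have "m = a \<or> m = b"
  proof (rule ccontr)
    assume interior: "\<not> (m = a \<or> m = b)"
    define h where "h = min (m - a) (b - m)"
    have "h > 0" "m - h \<in> {a..b}" "m + h \<in> {a..b}"
      using interior m_ab by (auto simp: h_def)
    have "f (((m - h) + (m + h)) / 2) \<le> (f (m - h) + f (m + h)) / 2"
      using conv \<open>m - h \<in> {a..b}\<close> \<open>m + h \<in> {a..b}\<close> unfolding midpoint_convex_on_def by blast
    then have "f m \<le> (f (m - h) + f (m + h)) / 2"
      by simp
    moreover have "f (m + h) \<le> f z"
      using z(2) \<open>m + h \<in> {a..b}\<close> by blast
    moreover have "f (m - h) < f z"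
      using z(2)[OF \<open>m - h \<in> {a..b}\<close>] m(2)[of "m - h"] \<open>h > 0\<close> \<open>m - h \<in> {a..b}\<close>
      by (force simp: S_def)
    ultimately show False
      using fm by simp
  qed
  then show ?thesis
    using z(2)[OF x] fm by (auto simp: max_def)
qed

lemma continuous_on_symmetrization:
  fixes f :: "real \<Rightarrow> real"
  assumes "continuous_on {a..b} f"
  shows "continuous_on {a..b} (\<lambda>x. f x + f (a + b - x))"
  by (intro continuous_on_add assms continuous_on_compose2[OF assms] continuous_intros) auto

lemma midpoint_convex_on_symmetrization:
  assumes "midpoint_convex_on {a..b} f"
  shows "midpoint_convex_on {a..b} (\<lambda>x. f x + f (a + b - x))"
  unfolding midpoint_convex_on_def
proof (intro ballI)
  fix x y assume xy: "x \<in> {a..b}" "y \<in> {a..b}"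
  have "f ((x + y) / 2) \<le> (f x + f y) / 2"
    using assms xy unfolding midpoint_convex_on_def by blast
  moreover have "f (((a + b - x) + (a + b - y)) / 2) \<le> (f (a + b - x) + f (a + b - y)) / 2"
  proof -
    have "a + b - x \<in> {a..b}" "a + b - y \<in> {a..b}"
      using xy by auto
    then show ?thesis
      using assms unfolding midpoint_convex_on_def by blast
  qed
  moreover have "((a + b - x) + (a + b - y)) / 2 = a + b - (x + y) / 2"
    by (simp add: field_simps)
  ultimately show "f ((x + y) / 2) + f (a + b - (x + y) / 2)
      \<le> ((f x + f (a + b - x)) + (f y + f (a + b - y))) / 2"
    by (simp add: field_simps)
qed

theorem corollary2p4:
  fixes f :: "real \<Rightarrow> real" and a b :: real
  assumes "a \<le> b"
    and "continuous_on {a..b} f"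
    and "midpoint_convex_on {a..b} f"
  shows "\<forall>p q :: real. p \<ge> 0 \<longrightarrow> q \<ge> 0 \<longrightarrow> p + q = 1 \<longrightarrow>
    2 * f ((a + b) / 2) \<le> f (p * a + q * b) + f (p * b + q * a) \<and>
    f (p * a + q * b) + f (p * b + q * a) \<le> f a + f b"
proof (intro allI impI)
  fix p q :: real
  assume pq: "p \<ge> 0" "q \<ge> 0" "p + q = 1"
  define x where "x = p * a + q * b"
  have q: "q = 1 - p"
    using pq(3) by simp
  have reflect: "p * b + q * a = a + b - x"
    by (simp add: x_def q algebra_simps)
  have x: "x \<in> {a..b}"
    using convex_bound_le[of a b b p q] convex_bound_le[of "- a" "- a" "- b" p q] pq \<open>a \<le> b\<close>
    by (simp add: x_def)
  then have "a + b - x \<in> {a..b}"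
    by simp
  then have "f ((x + (a + b - x)) / 2) \<le> (f x + f (a + b - x)) / 2"
    using assms(3) x unfolding midpoint_convex_on_def by blast
  then have "2 * f ((a + b) / 2) \<le> f x + f (a + b - x)"
    by simp
  moreover have "f x + f (a + b - x) \<le> f a + f b"
    using midpoint_convex_le_max_endpoints[OF continuous_on_symmetrization[OF assms(2)]
        midpoint_convex_on_symmetrization[OF assms(3)] x]
    by simp
  ultimately show "2 * f ((a + b) / 2) \<le> f (p * a + q * b) + f (p * b + q * a) \<and>
      f (p * a + q * b) + f (p * b + q * a) \<le> f a + f b"
    unfolding reflect x_def[symmetric] by blast
qed

end
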